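(* Let $0<b<1<a$ and let $\alpha\in(0,2]$ satisfy $ab^{\alpha}=1$. Let $\omega$ be the characteristic function of a semi-stable($a,b$) law on $\mathbf{R}$, and let $\varphi$ be the Laplace transform of a probability distribution on $[0,\infty)$. If $\varphi$ is semi-selfdecomposable($b^{\alpha}$), then the $\varphi$-semi-stable($a,b$) law with characteristic function $s\mapsto\varphi\{-\ln\omega(s)\}$ is semi-selfdecomposable($b$); that is, there exists a characteristic function $f_o$ such that $\varphi\{-\ln\omega(s)\}=\varphi\{-\ln\omega(bs)\}\,f_o(s)$ for all $s\in\mathbf{R}$.
   Context: Semi-stability is understood in the strict sense. For $0<b<1<a$, a characteristic function $\omega$ is semi-stable($a,b$) if it is infinitely divisible and $\omega(u)=\exp\{-\psi(u)\}$ with $\psi(u)=a\psi(bu)$ for all $u\in\mathbf{R}$, where $-\psi=\ln\omega$ is the continuous logarithm with $\psi(0)=0$; the exponent $\alpha\in(0,2]$ of the law is given by $ab^\alpha=1$. The Laplace transform of a probability distribution $F$ on $[0,\infty)$ is $\varphi(z)=\int_{[0,\infty)}e^{-zt}\,dF(t)$, for complex $z$ with $\mathrm{Re}\,z\ge 0$. For $c\in(0,1)$, a Laplace transform $\varphi$ is semi-selfdecomposable($c$), written semi-SD($c$), if there is a Laplace transform $\varphi_o$ of a probability distribution on $[0,\infty)$ with $\varphi(s)=\varphi(cs)\varphi_o(s)$ for all $s>0$. A law with characteristic function $\varphi\{-\ln\omega(s)\}$, where $\omega$ is semi-stable($a,b$), is called $\varphi$-semi-stable($a,b$). For $b\in(0,1)$,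 a distribution on $\mathbf{R}$ with characteristic function $f$ is semi-selfdecomposable($b$) if there is a characteristic function $f_o$ with $f(s)=f(bs)f_o(s)$ for all $s\in\mathbf{R}$. *)

theory Defs
  imports "HOL-Probability.Probability"
begin

definition char_fun :: "(real \<Rightarrow> complex) \<Rightarrow> bool" where
  "char_fun f \<longleftrightarrow> (\<exists>M. real_distribution M \<and> f = char M)"

definition infinitely_divisible :: "(real \<Rightarrow> complex) \<Rightarrow> bool" where
  "infinitely_divisible f \<longleftrightarrow>
     char_fun f \<and> (\<forall>n\<ge>1. \<exists>g. char_fun g \<and> (\<forall>u. f u = g u ^ n))"

text \<open>
  The continuous logarithm normalised to vanish at 0. It is not the principal branch
  \<open>Ln\<close>, and it is meaningful only for nowhere vanishing continuous \<open>f\<close> with \<open>f 0 = 1\<close>.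
\<close>

definition is_cont_log :: "(real \<Rightarrow> complex) \<Rightarrow> (real \<Rightarrow> complex) \<Rightarrow> bool" where
  "is_cont_log f L \<longleftrightarrow> continuous_on UNIV L \<and> L 0 = 0 \<and> (\<forall>u. exp (L u) = f u)"

definition cont_log :: "(real \<Rightarrow> complex) \<Rightarrow> real \<Rightarrow> complex" where
  "cont_log f = (THE L. is_cont_log f L)"

lemma is_cont_log_unique:
  assumes "is_cont_log f L" "is_cont_log f L'"
  shows "L = L'"
proof -
  let ?d = "\<lambda>u. L u - L' u"
  have ex: "exp (?d u) = 1" for u
    using assms by (simp add: is_cont_log_def exp_diff) (metis divide_self exp_not_eq_zero)
  have "?d constant_on UNIV"
  proof (rule continuous_discrete_range_constant)
    show "continuous_on UNIV ?d"
      using assms by (auto simp: is_cont_log_def intro!: continuous_intros)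
    show "\<exists>e>0. \<forall>y. y \<in> UNIV \<and> ?d y \<noteq> ?d x \<longrightarrow> e \<le> norm (?d y - ?d x)" for x
    proof (intro exI[of _ 1] conjI allI impI)
      fix y assume ne: "y \<in> UNIV \<and> ?d y \<noteq> ?d x"
      let ?w = "?d y - ?d x"
      have "exp ?w = 1"
        using ex[of x] ex[of y] by (metis div_by_1 exp_diff)
      then obtain n :: int where n: "Re ?w = 0" "Im ?w = of_int (2 * n) * pi"
        unfolding exp_eq_1 by auto
      with ne have "n \<noteq> 0"
        by (auto simp: complex_eq_iff)
      then have "1 \<le> \<bar>real_of_int n\<bar>"
        by linarith
      then have "1 * 1 \<le> \<bar>real_of_int n\<bar> * (2 * pi)"
        using pi_gt3 by (intro mult_mono) auto
      also have "\<dots> = \<bar>Im ?w\<bar>"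
        unfolding n by (simp add: abs_mult)
      also have "\<dots> \<le> norm ?w"
        by (rule abs_Im_le_cmod)
      finally show "1 \<le> norm ?w" by simp
    qed simp
  qed simp
  then obtain c where c: "\<And>u. ?d u = c"
    by (auto simp: constant_on_def)
  have "L 0 = 0" "L' 0 = 0"
    using assms by (simp_all add: is_cont_log_def)
  with c[of 0] have "c = 0"
    by simp
  with c show ?thesis
    by auto
qed

lemma cont_log_eq: "is_cont_log f L \<Longrightarrow> cont_log f = L"
  unfolding cont_log_def by (blast intro: is_cont_log_unique)

text \<open>
  Strict semi-stability. The witness \<open>\<psi>\<close> is necessarily \<open>\<lambda>u. - cont_log \<omega> u\<close>,
  by \<open>cont_log_eq\<close>.
\<close>

definition semi_stable :: "real \<Rightarrow> real \<Rightarrow> (real \<Rightarrow> complex) \<Rightarrow> bool" where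
  "semi_stable a b \<omega> \<longleftrightarrow>
     infinitely_divisible \<omega> \<and>
     (\<exists>\<psi>. is_cont_log \<omega> (\<lambda>u. - \<psi> u) \<and> (\<forall>u. \<psi> u = complex_of_real a * \<psi> (b * u)))"

text \<open>
  A Laplace transform is a function on the closed right half-plane; its values
  elsewhere are left unconstrained.
\<close>

definition laplace_transform :: "(complex \<Rightarrow> complex) \<Rightarrow> bool" where
  "laplace_transform \<phi> \<longleftrightarrow>
     (\<exists>F. real_distribution F \<and> measure F {0..} = 1 \<and>
       (\<forall>z. 0 \<le> Re z \<longrightarrow> \<phi> z = (CLINT t:{0..}|F. exp (- z * complex_of_real t))))"

definition semi_SD :: "real \<Rightarrow> (complex \<Rightarrow> complex) \<Rightarrow> bool" where
  "semi_SD c \<phi> \<longleftrightarrow>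
     laplace_transform \<phi> \<and>
     (\<exists>\<phi>\<^sub>o. laplace_transform \<phi>\<^sub>o \<and>
       (\<forall>s>0. \<phi> (complex_of_real s) = \<phi> (complex_of_real (c * s)) * \<phi>\<^sub>o (complex_of_real s)))"

definition semi_selfdecomposable :: "real \<Rightarrow> (real \<Rightarrow> complex) \<Rightarrow> bool" where
  "semi_selfdecomposable b f \<longleftrightarrow>
     char_fun f \<and> (\<exists>f\<^sub>o. char_fun f\<^sub>o \<and> (\<forall>s. f s = f (b * s) * f\<^sub>o s))"

end

(*
  Write omega = exp (- psi), so that Re psi >= 0 and psi (b s) = b^alpha psi s. The factorisation
  phi s = phi (c s) phi_o s, c = b^alpha, extends from s > 0 to Re s >= 0 by analytic continuation
  and continuity; putting psi s for s gives phi (psi s) = phi (psi (b s)) phi_o (psi s). It remains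
  to see that phi_o (psi s) is a characteristic function. It is a pointwise limit of mixtures of
  powers of the n-th roots exp (- psi / n), so this follows from Levy's continuity theorem in the
  form where the limit is only assumed to be continuous at 0. Tightness in that theorem comes from
  averaging the characteristic functions against a Gaussian.
*)

theory Submission
  imports Defs "HOL-Complex_Analysis.Complex_Analysis"
begin

section \<open>Closure properties of characteristic functions\<close>

lemma char_fun_cmod_le_1:
  assumes "char_fun f"
  shows "cmod (f s) \<le> 1"
  using assms real_distribution.cmod_char_le_1 by (auto simp: char_fun_def)

lemma char_fun_one: "char_fun (\<lambda>s. 1)"
proof -
  have "prob_space (return borel (0::real))"
    by (rule prob_space_return) simp
  then have "real_distribution (return borel (0::real))"
    by (simp add: real_distribution_def real_distribution_axioms_def)
  moreover have "char (return borel (0::real)) = (\<lambda>s. 1)"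
    by (auto simp: char_def integral_return)
  ultimately show ?thesis
    unfolding char_fun_def by metis
qed

text \<open>The product belongs to the sum of two independent variables, realised as the coordinates
  on \<open>M \<Otimes>\<^sub>M N\<close>.\<close>

lemma char_fun_mult:
  assumes "char_fun f" "char_fun g"
  shows "char_fun (\<lambda>s. f s * g s)"
proof -
  obtain M N where M: "real_distribution M" "f = char M" and N: "real_distribution N" "g = char N"
    using assms by (auto simp: char_fun_def)
  interpret M: real_distribution M by fact
  interpret N: real_distribution N by fact
  interpret P: pair_prob_space M N ..
  let ?D = "distr (M \<Otimes>\<^sub>M N) borel (\<lambda>p. fst p + snd p)"
  have "real_distribution ?D"
    by (rule P.real_distribution_distr) simp
  moreover have "char ?D s = f s * g s" for s
  proof -
    have "integrable (M \<Otimes>\<^sub>M N) (\<lambda>p. iexp (s * (fst p + snd p)))"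
      by (intro P.integrable_iexp) auto
    then have int: "integrable (M \<Otimes>\<^sub>M N) (\<lambda>(x, y). iexp (s * x) * iexp (s * y))"
      unfolding case_prod_beta by (simp add: ring_distribs exp_add)
    have "char ?D s = (CLINT p|M \<Otimes>\<^sub>M N. iexp (s * (fst p + snd p)))"
      by (simp add: char_def integral_distr)
    also have "\<dots> = (CLINT p|M \<Otimes>\<^sub>M N. (case p of (x, y) \<Rightarrow> iexp (s * x) * iexp (s * y)))"
      by (simp add: case_prod_beta ring_distribs exp_add)
    also have "\<dots> = (CLINT x|M. CLINT y|N. iexp (s * x) * iexp (s * y))"
      using P.integral_fst[OF int] by simp
    also have "\<dots> = f s * g s"
      by (simp add: char_def M(2) N(2) del: of_real_mult)
    finally show ?thesis .
  qed
  ultimately show ?thesis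
    unfolding char_fun_def by (intro exI[of _ ?D]) auto
qed

lemma char_fun_power:
  assumes "char_fun f"
  shows "char_fun (\<lambda>s. f s ^ n)"
  by (induction n) (auto intro: char_fun_one char_fun_mult assms)

text \<open>The law behind this integral is the \<open>F\<close>-mixture of the laws
  \<open>K (k t)\<close>, formed by \<open>bind\<close>. Because the index is a natural number, the
  kernel is measurable whatever the family \<open>g\<close> is.\<close>

lemma char_fun_mixture:
  fixes k :: "'a \<Rightarrow> nat"
  assumes F: "prob_space F" and k [measurable]: "k \<in> measurable F (count_space UNIV)"
    and g: "\<And>m. char_fun (g m)"
  shows "char_fun (\<lambda>s. CLINT t|F. g (k t) s)"
proof -
  interpret F: prob_space F by fact
  obtain K where K: "\<And>m. real_distribution (K m)" "\<And>m. g m = char (K m)"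
    using g unfolding char_fun_def by metis
  interpret K: real_distribution "K m" for m by (rule K)
  have Kmeas: "K \<in> measurable (count_space UNIV) (subprob_algebra borel)"
    by (auto simp: space_subprob_algebra K.prob_space_axioms prob_space_imp_subprob_space)
  have kern: "(\<lambda>t. K (k t)) \<in> measurable F (subprob_algebra borel)"
    by (rule measurable_compose[OF k Kmeas])
  let ?D = "F \<bind> (\<lambda>t. K (k t))"
  have "prob_space ?D"
    by (rule F.prob_space_bind[OF _ kern]) (simp add: K.prob_space_axioms)
  moreover have "sets ?D = sets borel"
    by (rule sets_bind) (auto simp: F.not_empty)
  ultimately have D: "real_distribution ?D"
    by (simp add: real_distribution_def real_distribution_axioms_def)
  \<comment> \<open>Integration against the mixture is iterated integration. Bounded real integrands
    suffice, since \<open>iexp\<close> is treated below through its real and imaginary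
    parts.\<close>
  have real_int: "(LINT x|?D. h x) = (LINT t|F. LINT x|K (k t). h x)"
    if "h \<in> borel_measurable borel" "\<And>x. \<bar>h x\<bar> \<le> 1" for h :: "real \<Rightarrow> real"
  proof (rule integral_bind[OF that(1) _ kern])
    show "finite_measure F" by unfold_locales
    show "AE t in F. emeasure (K (k t)) (space (K (k t))) \<le> ennreal 1"
      by (simp only: K.emeasure_space_1) simp
  qed (use that in auto)
  have "char ?D s = (CLINT t|F. g (k t) s)" for s
  proof -
    interpret D: real_distribution ?D by fact
    have iD: "integrable ?D (\<lambda>x. iexp (s * x))"
      by (rule D.integrable_iexp) (auto simp: D.events_eq_borel)
    have iK: "integrable (K m) (\<lambda>x. iexp (s * x))" for m
      by (rule K.integrable_iexp) auto
    have iF: "integrable F (\<lambda>t. g (k t) s)"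
    proof (rule F.integrable_const_bound[of _ 1])
      show "(\<lambda>t. g (k t) s) \<in> borel_measurable F"
        by (rule measurable_compose[OF k]) simp
    qed (simp add: K(2) K.cmod_char_le_1)
    have cos_le: "\<bar>Re (iexp (s * x))\<bar> \<le> 1" "\<bar>Im (iexp (s * x))\<bar> \<le> 1" for x
      by (simp_all add: Re_exp Im_exp)
    have "Re (char ?D s) = (LINT x|?D. Re (iexp (s * x)))"
      unfolding char_def by (rule integral_Re[OF iD, symmetric])
    also have "\<dots> = (LINT t|F. LINT x|K (k t). Re (iexp (s * x)))"
      by (rule real_int[OF _ cos_le(1)]) measurable
    also have "\<dots> = (LINT t|F. Re (g (k t) s))"
      by (simp only: integral_Re[OF iK] K(2) char_def)
    also have "\<dots> = Re (CLINT t|F. g (k t) s)"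
      by (rule integral_Re[OF iF])
    finally have re: "Re (char ?D s) = Re (CLINT t|F. g (k t) s)" .
    have "Im (char ?D s) = (LINT x|?D. Im (iexp (s * x)))"
      unfolding char_def by (rule integral_Im[OF iD, symmetric])
    also have "\<dots> = (LINT t|F. LINT x|K (k t). Im (iexp (s * x)))"
      by (rule real_int[OF _ cos_le(2)]) measurable
    also have "\<dots> = (LINT t|F. Im (g (k t) s))"
      by (simp only: integral_Im[OF iK] K(2) char_def)
    also have "\<dots> = Im (CLINT t|F. g (k t) s)"
      by (rule integral_Im[OF iF])
    finally show ?thesis
      using re by (simp add: complex_eq_iff)
  qed
  with D show ?thesis
    unfolding char_fun_def by (intro exI[of _ ?D]) auto
qed

section \<open>Tightness and the Levy continuity theorem\<close>

text \<open>
  Both sides are \<open>E (exp (\<i> \<sigma> T X))\<close> for independent \<open>X\<close> and a standard normal \<open>T\<close>.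
\<close>

lemma (in real_distribution) integral_char_std_normal:
  "(CLINT t|std_normal_distribution. char M (\<sigma> * t)) =
    complex_of_real (LINT x|M. exp (- ((\<sigma> * x)\<^sup>2) / 2))"
proof -
  interpret N: real_distribution std_normal_distribution
    by (rule real_dist_normal_dist)
  interpret P: pair_prob_space M std_normal_distribution ..
  have int: "integrable (M \<Otimes>\<^sub>M std_normal_distribution)
      (\<lambda>(x, t). iexp (\<sigma> * t * x))"
    unfolding case_prod_beta by (intro P.integrable_iexp) auto
  have "(CLINT t|std_normal_distribution. char M (\<sigma> * t)) =
      (CLINT x|M. CLINT t|std_normal_distribution. iexp (\<sigma> * t * x))"
    unfolding char_def by (rule P.Fubini_integral[OF int])
  also have "\<dots> = (CLINT x|M. char std_normal_distribution (\<sigma> * x))"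
    by (simp add: char_def mult_ac)
  also have "\<dots> = (CLINT x|M. complex_of_real (exp (- ((\<sigma> * x)\<^sup>2) / 2)))"
    by (simp only: char_std_normal_distribution)
  also have "\<dots> = complex_of_real (LINT x|M. exp (- ((\<sigma> * x)\<^sup>2) / 2))"
    by (rule integral_complex_of_real)
  finally show ?thesis .
qed

text \<open>By the preceding identity with \<open>\<sigma> = 1 / r\<close>, the right-hand side is
  the modulus of the mean of \<open>1 - exp (- ((x / r)\<^sup>2) / 2)\<close>. This integrand is
  nonnegative, and at least \<open>1 - exp (- 1 / 2)\<close> where
  \<open>r \<le> \<bar>x\<bar>\<close>.\<close>

lemma (in real_distribution) tail_le_integral_char:
  assumes "0 < r"
  shows "(1 - exp (- 1 / 2)) * measure M {x. r \<le> \<bar>x\<bar>} \<le>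
    cmod (1 - (CLINT t|std_normal_distribution. char M (t / r)))"
proof -
  let ?h = "\<lambda>x. exp (- ((x / r)\<^sup>2) / 2) :: real"
  have int: "integrable M ?h"
    by (rule integrable_const_bound[of _ 1]) auto
  have "(1 - exp (- 1 / 2)) * measure M {x. r \<le> \<bar>x\<bar>} =
      (LINT x|M. (1 - exp (- 1 / 2)) * indicator {x. r \<le> \<bar>x\<bar>} x)"
    by simp
  also have "\<dots> \<le> (LINT x|M. 1 - ?h x)"
  proof (rule integral_mono)
    show "integrable M (\<lambda>x. (1 - exp (- 1 / 2)) * indicator {x. r \<le> \<bar>x\<bar>} x :: real)"
      by (intro integrable_mult_right integrable_real_indicator) (auto simp: emeasure_eq_measure)
    show "integrable M (\<lambda>x. 1 - ?h x)"
      using int by simp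
    fix x
    have "1 \<le> (x / r)\<^sup>2" if "r \<le> \<bar>x\<bar>"
    proof -
      have "1 \<le> \<bar>x\<bar> / r"
        using that assms by simp
      then have "1\<^sup>2 \<le> (\<bar>x\<bar> / r)\<^sup>2"
        by (intro power_mono) auto
      then show ?thesis
        by (simp add: power_divide)
    qed
    then show "(1 - exp (- 1 / 2)) * indicator {x. r \<le> \<bar>x\<bar>} x \<le> 1 - ?h x"
      by (auto split: split_indicator)
  qed
  also have "\<dots> = 1 - (LINT x|M. ?h x)"
    using int prob_space by (simp del: space_eq_univ)
  also have "\<dots> = Re (1 - complex_of_real (LINT x|M. ?h x))"
    by simp
  also have "\<dots> \<le> cmod (1 - complex_of_real (LINT x|M. ?h x))"
    by (rule complex_Re_le_cmod)
  also have "complex_of_real (LINT x|M. ?h x) = (CLINT t|std_normal_distribution. char M (t / r))"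
    using integral_char_std_normal[of "1 / r"] by simp
  finally show ?thesis .
qed

lemma (in real_distribution) ex_interval_measure_gt:
  assumes "0 < \<epsilon>"
  shows "\<exists>K::nat. 1 - \<epsilon> < measure M {- real K<..real K}"
proof -
  have "(\<Union>k::nat. {- real k<..real k}) = UNIV"
    by (auto, metis leI le_less_trans less_imp_le minus_less_iff reals_Archimedean2)
  moreover have "(\<lambda>k. measure M {- real k<..real k}) \<longlonglongrightarrow> measure M (\<Union>k::nat. {- real k<..real k})"
    by (rule finite_Lim_measure_incseq) (auto simp: incseq_def)
  ultimately have "(\<lambda>k. measure M {- real k<..real k}) \<longlonglongrightarrow> 1"
    using prob_space by simp
  then have "eventually (\<lambda>k. 1 - \<epsilon> < measure M {- real k<..real k}) sequentially"
    by (rule order_tendstoD) (use assms in simp)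
  then show ?thesis
    by (auto simp: eventually_sequentially)
qed

text \<open>Continuity at 0 makes the Gaussian average of \<open>h\<close> at a small scale close to
  1; pointwise convergence then makes the averages of \<open>char (M n)\<close> at that same scale
  close to 1 for all large \<open>n\<close>. The tail estimate turns this into a common
  interval.\<close>

lemma tight_if_char_tendsto:
  assumes M: "\<And>n. real_distribution (M n)"
    and lim: "\<And>t. (\<lambda>n. char (M n) t) \<longlonglongrightarrow> h t" and cont: "isCont h 0"
  shows "tight M"
  unfolding tight_def
proof (intro conjI allI impI M)
  fix \<epsilon> :: real
  assume \<epsilon>: "0 < \<epsilon>"
  interpret M: real_distribution "M n" for n by (rule M)
  interpret N: real_distribution std_normal_distribution
    by (rule real_dist_normal_dist)
  define c :: real where "c = 1 - exp (- 1 / 2)"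
  have c: "0 < c"
    by (simp add: c_def)
  have h0: "h 0 = 1"
    using lim[of 0] by (simp add: M.char_zero LIMSEQ_const_iff)
  \<comment> \<open>Bound and measurability pass to the limit from the functions
    \<open>char (M n)\<close>. As \<open>h\<close> is assumed continuous only at 0, they are what
    makes its Gaussian averages accessible to dominated convergence.\<close>
  have h_le: "cmod (h t) \<le> 1" for t
    by (rule Lim_bounded[OF tendsto_norm[OF lim], of 0]) (simp add: M.cmod_char_le_1)
  have h_meas [measurable]: "h \<in> borel_measurable borel"
    by (rule borel_measurable_LIMSEQ_metric[OF _ lim]) simp
  have G: "(\<lambda>k. CLINT t|std_normal_distribution. h (t / real (Suc k)))
      \<longlonglongrightarrow> (CLINT t|std_normal_distribution. 1)"
  proof (rule integral_dominated_convergence[where w="\<lambda>_. 1"])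
    show "AE t in std_normal_distribution. (\<lambda>k. h (t / real (Suc k))) \<longlonglongrightarrow> 1"
    proof (rule AE_I2)
      fix t :: real
      have "(\<lambda>k. t / real (Suc k)) \<longlonglongrightarrow> 0"
        by (rule LIMSEQ_Suc[OF lim_const_over_n])
      from isCont_tendsto_compose[OF cont this] show "(\<lambda>k. h (t / real (Suc k))) \<longlonglongrightarrow> 1"
        by (simp add: h0)
    qed
  qed (auto simp: h_le)
  have "(CLINT t|std_normal_distribution. 1) = 1"
    using N.prob_space by (simp del: N.space_eq_univ)
  \<comment> \<open>Two approximations, each with error below \<open>c * \<epsilon> / 2\<close>,
    bound \<open>c\<close> times the tail mass by \<open>c * \<epsilon>\<close>; dividing by
    \<open>c\<close> leaves \<open>\<epsilon>\<close>.\<close>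
  with G have "eventually (\<lambda>k. dist (CLINT t|std_normal_distribution. h (t / real (Suc k))) 1 < c * \<epsilon> / 2)
      sequentially"
    using c \<epsilon> by (intro tendstoD) auto
  then obtain k where k: "cmod (1 - (CLINT t|std_normal_distribution. h (t / real (Suc k)))) < c * \<epsilon> / 2"
    by (auto simp: eventually_sequentially dist_norm norm_minus_commute)
  have "(\<lambda>n. CLINT t|std_normal_distribution. char (M n) (t / real (Suc k)))
      \<longlonglongrightarrow> (CLINT t|std_normal_distribution. h (t / real (Suc k)))"
    by (rule integral_dominated_convergence[where w="\<lambda>_. 1"])
       (auto simp: lim M.cmod_char_le_1 simp del: of_nat_Suc)
  then have "eventually (\<lambda>n. dist (CLINT t|std_normal_distribution. char (M n) (t / real (Suc k)))
      (CLINT t|std_normal_distribution. h (t / real (Suc k))) < c * \<epsilon> / 2) sequentially"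
    using c \<epsilon> by (intro tendstoD) auto
  then obtain n0 where n0: "\<And>n. n0 \<le> n \<Longrightarrow>
      cmod ((CLINT t|std_normal_distribution. h (t / real (Suc k))) -
        (CLINT t|std_normal_distribution. char (M n) (t / real (Suc k)))) < c * \<epsilon> / 2"
    by (auto simp: eventually_sequentially dist_norm norm_minus_commute)
  have large: "1 - \<epsilon> < measure (M n) {- real (Suc k)<..real (Suc k)}" if "n0 \<le> n" for n
  proof -
    have "c * measure (M n) {x. real (Suc k) \<le> \<bar>x\<bar>} \<le>
        cmod (1 - (CLINT t|std_normal_distribution. char (M n) (t / real (Suc k))))"
      unfolding c_def by (rule M.tail_le_integral_char) simp
    also have "\<dots> < c * \<epsilon> / 2 + c * \<epsilon> / 2"
      by (rule norm_diff_triangle_less[OF k n0[OF that]])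
    finally have *: "measure (M n) {x. real (Suc k) \<le> \<bar>x\<bar>} < \<epsilon>"
      using c by simp
    have "1 - measure (M n) {x. real (Suc k) \<le> \<bar>x\<bar>} = measure (M n) (UNIV - {x. real (Suc k) \<le> \<bar>x\<bar>})"
      using M.prob_compl[of "{x. real (Suc k) \<le> \<bar>x\<bar>}" n] by simp
    also have "\<dots> \<le> measure (M n) {- real (Suc k)<..real (Suc k)}"
      by (rule M.finite_measure_mono) auto
    finally show ?thesis
      using * by simp
  qed
  obtain K where K: "\<And>n. 1 - \<epsilon> < measure (M n) {- real (K n)<..real (K n)}"
    using M.ex_interval_measure_gt[OF \<epsilon>] by metis
  \<comment> \<open>The radius \<open>Suc k\<close> serves every \<open>n\<close> from
    \<open>n0\<close> on; the finitely many earlier laws contribute their own radii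
    \<open>K n\<close>.\<close>
  define B where "B = real (Max (insert (Suc k) (K ` {..<n0})))"
  have B: "real (Suc k) \<le> B" "\<And>n. n < n0 \<Longrightarrow> real (K n) \<le> B"
    unfolding B_def by (intro of_nat_mono Max_ge; simp)+
  have "1 - \<epsilon> < measure (M n) {- B<..B}" for n
  proof (cases "n < n0")
    case True
    with B(2)[of n] show ?thesis
      by (intro less_le_trans[OF K[of n]] M.finite_measure_mono) auto
  next
    case False
    with B(1) show ?thesis
      by (intro less_le_trans[OF large[of n]] M.finite_measure_mono) auto
  qed
  moreover have "- B < B"
    using B(1) by simp
  ultimately show "\<exists>a b. a < b \<and> (\<forall>n. 1 - \<epsilon> < measure (M n) {a<..b})"
    by blast
qed

text \<open>Tightness yields a weak limit along a subsequence. One subsequence is enough: the full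
  sequence already converges pointwise to \<open>h\<close>, so \<open>h\<close> must be the
  characteristic function of that weak limit.\<close>

theorem char_fun_limit:
  assumes f: "\<And>n. char_fun (f n)" and lim: "\<And>t. (\<lambda>n. f n t) \<longlonglongrightarrow> h t" and cont: "isCont h 0"
  shows "char_fun h"
proof -
  obtain M where M: "\<And>n. real_distribution (M n)" "\<And>n. f n = char (M n)"
    using f unfolding char_fun_def by metis
  have "tight M"
    using lim by (intro tight_if_char_tendsto[OF M(1) _ cont]) (simp add: M(2))
  from tight_imp_convergent_subsubsequence[OF this strict_mono_id]
  obtain r \<nu> where r: "strict_mono r" and \<nu>: "real_distribution \<nu>" "weak_conv_m (M \<circ> r) \<nu>"
    by auto
  have "h t = char \<nu> t" for t
  proof (rule LIMSEQ_unique)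
    show "((\<lambda>n. f n t) \<circ> r) \<longlonglongrightarrow> h t"
      by (rule LIMSEQ_subseq_LIMSEQ[OF lim r])
    show "((\<lambda>n. f n t) \<circ> r) \<longlonglongrightarrow> char \<nu> t"
      using levy_continuity1[OF _ \<nu>, of t] by (simp add: M o_def)
  qed
  with \<nu>(1) show ?thesis
    unfolding char_fun_def by blast
qed

section \<open>Roots of an infinitely divisible characteristic function\<close>

text \<open>Infinite divisibility provides some root \<open>g\<close>; this identifies it. The
  quotient of \<open>g\<close> by \<open>exp (- \<psi> / n)\<close> is continuous and takes values
  in the finite set of \<open>n\<close>-th roots of unity, so it is constant, and it equals 1 at
  0.\<close>

lemma root_eq_exp_cont_log:
  assumes log: "is_cont_log \<omega> (\<lambda>u. - \<psi> u)" and g: "char_fun g"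
    and root: "\<And>u. \<omega> u = g u ^ n" and n: "1 \<le> n"
  shows "g u = exp (- \<psi> u / of_nat n)"
proof -
  have \<psi>: "continuous_on UNIV \<psi>" "\<psi> 0 = 0" "\<And>u. exp (- \<psi> u) = \<omega> u"
    using log continuous_on_minus[of UNIV "\<lambda>u. - \<psi> u"] by (auto simp: is_cont_log_def)
  obtain M where M: "real_distribution M" "g = char M"
    using g by (auto simp: char_fun_def)
  interpret M: real_distribution M by fact
  have g_cont: "continuous_on UNIV g"
    by (auto simp: M(2) intro: continuous_at_imp_continuous_on M.isCont_char)
  define q where "q u = g u * exp (\<psi> u / of_nat n)" for u
  have "q u ^ n = 1" for u
  proof -
    have "q u ^ n = \<omega> u * exp (\<psi> u)"
      using n by (simp add: q_def power_mult_distrib root exp_of_nat_mult[symmetric])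
    then show ?thesis
      by (simp add: \<psi>(3)[symmetric] exp_minus)
  qed
  then have "range q \<subseteq> {z. z ^ n = 1}"
    by auto
  then have "finite (range q)"
    by (rule finite_subset) (rule finite_roots_unity[OF n])
  moreover have "continuous_on UNIV q"
    unfolding q_def using n by (intro continuous_intros g_cont \<psi>(1)) auto
  ultimately have "q constant_on UNIV"
    by (intro continuous_finite_range_constant) auto
  then have "q u = q 0"
    by (auto simp: constant_on_def)
  also have "q 0 = 1"
    by (simp add: q_def \<psi>(2) M(2) M.char_zero)
  finally show ?thesis
    by (simp add: q_def exp_minus field_simps)
qed

section \<open>Laplace transforms on the right half-plane\<close>

lemma laplace_transformE:
  assumes "laplace_transform \<phi>"
  obtains F where "real_distribution F" "AE t in F. 0 \<le> t"
    "\<And>z. 0 \<le> Re z \<Longrightarrow> \<phi> z = (CLINT t|F. exp (- z * complex_of_real t))"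
proof -
  obtain F where F: "real_distribution F" "measure F {0..} = 1"
    "\<And>z. 0 \<le> Re z \<Longrightarrow> \<phi> z = (CLINT t:{0..}|F. exp (- z * complex_of_real t))"
    using assms unfolding laplace_transform_def by blast
  interpret F: real_distribution F by fact
  have ae: "AE t in F. 0 \<le> t"
    using F.AE_in_set_eq_1[of "{0..}"] F(2) by simp
  have "(CLINT t:{0..}|F. exp (- z * complex_of_real t)) = (CLINT t|F. exp (- z * complex_of_real t))" for z
    unfolding set_lebesgue_integral_def
    by (rule integral_cong_AE) (use ae in auto)
  with F(1,3) ae that show thesis
    by metis
qed

text \<open>The kernel has modulus at most 1 for \<open>0 \<le> Re z\<close> and
  \<open>0 \<le> t\<close>, so dominated convergence works up to and including the imaginary
  axis.\<close>

lemma continuous_on_laplace_transform: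
  assumes "laplace_transform \<phi>"
  shows "continuous_on {z. 0 \<le> Re z} \<phi>"
  using assms
proof (rule laplace_transformE)
  fix F assume F: "real_distribution F" "AE t in F. 0 \<le> t"
    "\<And>z. 0 \<le> Re z \<Longrightarrow> \<phi> z = (CLINT t|F. exp (- z * complex_of_real t))"
  interpret F: real_distribution F by fact
  have "continuous_on {z. 0 \<le> Re z} (\<lambda>z. CLINT t|F. exp (- z * complex_of_real t))"
    unfolding continuous_on_sequentially
  proof (intro allI ballI impI)
    fix X :: "nat \<Rightarrow> complex" and z
    assume "z \<in> {z. 0 \<le> Re z}" and "(\<forall>n. X n \<in> {z. 0 \<le> Re z}) \<and> X \<longlonglongrightarrow> z"
    then have X: "0 \<le> Re (X n)" "X \<longlonglongrightarrow> z" for n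
      by auto
    show "((\<lambda>z. CLINT t|F. exp (- z * complex_of_real t)) \<circ> X)
        \<longlonglongrightarrow> (CLINT t|F. exp (- z * complex_of_real t))"
      unfolding comp_def
    proof (rule integral_dominated_convergence[where w="\<lambda>_. 1"])
      show "AE t in F. (\<lambda>n. exp (- X n * complex_of_real t)) \<longlonglongrightarrow> exp (- z * complex_of_real t)"
        by (intro AE_I2 tendsto_intros X(2))
      show "AE t in F. norm (exp (- X n * complex_of_real t)) \<le> 1" for n
        using F(2) by eventually_elim (simp add: norm_exp_eq_Re X(1))
    qed auto
  qed
  then show ?thesis
    by (rule continuous_on_eq) (use F(3) in auto)
qed

text \<open>Differentiation under the integral sign: the difference quotients are bounded uniformly
  in \<open>t\<close> on a half-plane that stays away from the imaginary axis, so dominated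
  convergence applies.\<close>

lemma holomorphic_on_laplace_transform:
  assumes "laplace_transform \<phi>"
  shows "\<phi> holomorphic_on {z. 0 < Re z}"
  using assms
proof (rule laplace_transformE)
  fix F assume F: "real_distribution F" "AE t in F. 0 \<le> t"
    "\<And>z. 0 \<le> Re z \<Longrightarrow> \<phi> z = (CLINT t|F. exp (- z * complex_of_real t))"
  interpret F: real_distribution F by fact
  have exp_int: "integrable F (\<lambda>t. exp (- z * complex_of_real t))" if "0 \<le> Re z" for z
    by (rule F.integrable_const_bound[of _ 1]) (use F(2) that in \<open>auto simp: norm_exp_eq_Re\<close>)
  show ?thesis
  proof (rule holomorphic_onI)
    fix z assume "z \<in> {z. 0 < Re z}"
    \<comment> \<open>Half the distance from \<open>z\<close> to the imaginary axis:
      \<open>?S\<close> is then an open convex neighbourhood of \<open>z\<close> on which the factor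
      \<open>exp (- \<delta> * t)\<close> absorbs the growth of \<open>t\<close>.\<close>
    define \<delta> where "\<delta> = Re z / 2"
    have \<delta>: "0 < \<delta>" "\<delta> < Re z"
      using \<open>z \<in> _\<close> by (auto simp: \<delta>_def)
    let ?S = "{w. \<delta> < Re w}"
    let ?Q = "\<lambda>w t. (exp (- w * complex_of_real t) - exp (- z * complex_of_real t)) / (w - z)"
    let ?D = "\<lambda>w t. - complex_of_real t * exp (- w * complex_of_real t)"
    have deriv: "((\<lambda>w. exp (- w * complex_of_real t)) has_field_derivative ?D w t) (at w within A)"
      for w t A
      by (auto intro!: derivative_eq_intros)
    have Q_le: "norm (?Q w t) \<le> 1 / \<delta>" if "0 \<le> t" "w \<in> ?S" for w t
    proof -
      have "norm (?D u t) \<le> 1 / \<delta>" if "u \<in> ?S" for u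
      proof -
        have "\<delta> * t \<le> exp (\<delta> * t)"
          using exp_ge_add_one_self[of "\<delta> * t"] by linarith
        then have "t * exp (- (\<delta> * t)) \<le> 1 / \<delta>"
          using \<delta>(1) by (simp add: exp_minus field_simps)
        moreover have "exp (- (Re u * t)) \<le> exp (- (\<delta> * t))"
          using that \<open>0 \<le> t\<close> by (auto intro!: mult_right_mono)
        then have "t * exp (- (Re u * t)) \<le> t * exp (- (\<delta> * t))"
          using \<open>0 \<le> t\<close> by (rule mult_left_mono)
        ultimately show ?thesis
          using \<open>0 \<le> t\<close> by (simp add: norm_mult norm_exp_eq_Re)
      qed
      \<comment> \<open>Mean value inequality on the convex set \<open>?S\<close>, from the
        derivative bound just shown.\<close>
      then have "norm (exp (- w * complex_of_real t) - exp (- z * complex_of_real t)) \<le> 1 / \<delta> * norm (w - z)"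
        using \<open>w \<in> ?S\<close> \<delta>
        by (intro field_differentiable_bound[OF convex_halfspace_Re_gt deriv]) auto
      \<comment> \<open>For \<open>w = z\<close> the quotient is 0 by the convention for division by
        0.\<close>
      then show ?thesis
        by (cases "w = z") (use \<delta> in \<open>auto simp: norm_divide field_simps\<close>)
    qed
    have "((\<lambda>w. (\<phi> w - \<phi> z) / (w - z)) \<longlongrightarrow> (CLINT t|F. ?D z t)) (at z within ?S)"
      unfolding tendsto_at_iff_sequentially
    proof (intro allI impI)
      fix X assume X: "\<forall>i. X i \<in> ?S - {z}" "X \<longlonglongrightarrow> z"
      have "(\<lambda>i. CLINT t|F. ?Q (X i) t) \<longlonglongrightarrow> (CLINT t|F. ?D z t)"
      proof (rule integral_dominated_convergence[where w="\<lambda>_. 1 / \<delta>"])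
        show "AE t in F. (\<lambda>i. ?Q (X i) t) \<longlonglongrightarrow> ?D z t"
        proof (rule AE_I2)
          fix t
          show "(\<lambda>i. ?Q (X i) t) \<longlonglongrightarrow> ?D z t"
            using deriv[of t z ?S] X
            unfolding has_field_derivative_iff tendsto_at_iff_sequentially comp_def by blast
        qed
        show "AE t in F. norm (?Q (X i) t) \<le> 1 / \<delta>" for i
          using F(2) by eventually_elim (use X Q_le in blast)
      qed auto
      moreover have "(CLINT t|F. ?Q (X i) t) = (\<phi> (X i) - \<phi> z) / (X i - z)" for i
      proof -
        have "0 \<le> Re (X i)" "0 \<le> Re z"
          using X(1) \<delta> by (auto dest: spec[of _ i])
        then show ?thesis
          using F(3)[of "X i"] F(3)[of z] exp_int[of "X i"] exp_int[of z] by simp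
      qed
      ultimately show "((\<lambda>w. (\<phi> w - \<phi> z) / (w - z)) \<circ> X) \<longlonglongrightarrow> (CLINT t|F. ?D z t)"
        unfolding comp_def by (simp only:)
    qed
    then have "(\<phi> has_field_derivative (CLINT t|F. ?D z t)) (at z within ?S)"
      by (simp add: has_field_derivative_iff)
    moreover have "at z within ?S = at z"
      by (rule at_within_open) (use \<delta> open_halfspace_Re_gt in auto)
    ultimately show "\<phi> field_differentiable at z within {z. 0 < Re z}"
      by (auto simp: field_differentiable_def intro: has_field_derivative_at_within)
  qed
qed

text \<open>The positive reals accumulate at the interior point 1, so the identity theorem carries
  the factorisation to the open half-plane; continuity then reaches the imaginary axis.\<close>

lemma semi_SD_halfplane:
  assumes c: "0 < c" and \<phi>: "laplace_transform \<phi>" and \<phi>\<^sub>o: "laplace_transform \<phi>\<^sub>o"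
    and fact: "\<And>s. 0 < s \<Longrightarrow>
      \<phi> (complex_of_real s) = \<phi> (complex_of_real (c * s)) * \<phi>\<^sub>o (complex_of_real s)"
    and z: "0 \<le> Re z"
  shows "\<phi> z = \<phi> (complex_of_real c * z) * \<phi>\<^sub>o z"
proof -
  let ?H = "\<lambda>z. \<phi> z - \<phi> (complex_of_real c * z) * \<phi>\<^sub>o z"
  have "(\<phi> \<circ> (\<lambda>z. complex_of_real c * z)) holomorphic_on {z. 0 < Re z}"
    by (rule holomorphic_on_compose_gen[OF _ holomorphic_on_laplace_transform[OF \<phi>]])
       (use c in \<open>auto intro!: holomorphic_intros\<close>)
  then have "(\<lambda>z. \<phi> (complex_of_real c * z)) holomorphic_on {z. 0 < Re z}"
    by (simp add: comp_def)
  then have hol: "?H holomorphic_on {z. 0 < Re z}"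
    by (intro holomorphic_on_diff holomorphic_on_mult holomorphic_on_laplace_transform[OF \<phi>]
        holomorphic_on_laplace_transform[OF \<phi>\<^sub>o])
  have open_zero: "?H w = 0" if "0 < Re w" for w
  proof (rule analytic_continuation[OF hol, of "complex_of_real ` {0<..}" 1])
    show "1 islimpt complex_of_real ` {0<..}"
      unfolding islimpt_sequential
    proof (intro exI conjI allI)
      show "(\<lambda>n. complex_of_real (1 + inverse (real (Suc n)))) \<longlonglongrightarrow> 1"
        using tendsto_of_real[OF tendsto_add[OF tendsto_const LIMSEQ_inverse_real_of_nat, of 1]]
        by (simp del: of_real_add of_nat_Suc)
    qed (auto simp: add_pos_pos simp del: of_real_add)
  qed (use that fact in \<open>auto intro!: open_halfspace_Re_gt convex_connected convex_halfspace_Re_gt\<close>)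
  have cont: "continuous_on {z. 0 \<le> Re z} ?H"
    using c by (intro continuous_intros continuous_on_laplace_transform[OF \<phi>]
        continuous_on_laplace_transform[OF \<phi>\<^sub>o]
        continuous_on_compose2[OF continuous_on_laplace_transform[OF \<phi>]]) auto
  \<comment> \<open>Shifting \<open>z\<close> to the right by \<open>1 / (n + 1)\<close> puts it in
    the open half-plane, even if \<open>z\<close> lies on the boundary.\<close>
  have "(\<lambda>n. z + complex_of_real (inverse (real (Suc n)))) \<longlonglongrightarrow> z + complex_of_real 0"
    by (intro tendsto_add tendsto_const tendsto_of_real LIMSEQ_inverse_real_of_nat)
  then have lim: "(\<lambda>n. z + complex_of_real (inverse (real (Suc n)))) \<longlonglongrightarrow> z"
    by simp
  have "(\<lambda>n. ?H (z + complex_of_real (inverse (real (Suc n))))) \<longlonglongrightarrow> ?H z"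
    by (rule continuous_on_tendsto_compose[OF cont lim]) (use z in auto)
  moreover have "?H (z + complex_of_real (inverse (real (Suc n)))) = 0" for n
    by (rule open_zero) (use z in \<open>simp add: add_nonneg_pos\<close>)
  ultimately have "?H z = 0"
    by (simp add: LIMSEQ_const_iff)
  then show ?thesis
    by simp
qed

section \<open>Laplace transforms evaluated at the exponent of an infinitely divisible law\<close>

text \<open>Ensures that \<open>\<psi>\<close> takes values in the closed half-plane, where
  \<open>laplace_transform\<close> determines \<open>\<phi>\<close>. It holds because
  \<open>exp (- Re (\<psi> u))\<close> is the modulus of \<open>\<omega> u\<close>.\<close>

lemma Re_nonneg_if_char_fun:
  assumes "char_fun \<omega>" "is_cont_log \<omega> (\<lambda>u. - \<psi> u)"
  shows "0 \<le> Re (\<psi> u)"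
proof -
  have "exp (- Re (\<psi> u)) = cmod (\<omega> u)"
    using assms(2) norm_exp_eq_Re[of "- \<psi> u"] by (simp add: is_cont_log_def)
  also have "\<dots> \<le> 1"
    by (rule char_fun_cmod_le_1[OF assms(1)])
  finally show ?thesis
    by simp
qed

text \<open>
  With \<open>F\<close> replaced by the law of \<open>\<lfloor>n T\<rfloor> / n\<close>, the integral \<open>\<integral> exp (- t \<psi>(s)) dF(t)\<close> becomes a
  mixture of powers of the characteristic function \<open>exp (- \<psi> / n)\<close>; then let \<open>n\<close> tend to infinity.
\<close>

lemma char_fun_laplace_transform:
  assumes \<phi>: "laplace_transform \<phi>" and \<omega>: "infinitely_divisible \<omega>"
    and log: "is_cont_log \<omega> (\<lambda>u. - \<psi> u)"
  shows "char_fun (\<lambda>s. \<phi> (\<psi> s))"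
  using \<phi>
proof (rule laplace_transformE)
  fix F assume F: "real_distribution F" "AE t in F. 0 \<le> t"
    "\<And>z. 0 \<le> Re z \<Longrightarrow> \<phi> z = (CLINT t|F. exp (- z * complex_of_real t))"
  interpret F: real_distribution F by fact
  have Re_\<psi>: "0 \<le> Re (\<psi> s)" for s
    using \<omega> log by (intro Re_nonneg_if_char_fun) (auto simp: infinitely_divisible_def)
  have \<psi>_cont: "continuous_on UNIV \<psi>"
    using log continuous_on_minus[of UNIV "\<lambda>u. - \<psi> u"] by (simp add: is_cont_log_def)
  \<comment> \<open>\<open>Suc n\<close> in place of \<open>n\<close> avoids division by 0, so
    \<open>g n\<close> is the root of order \<open>n + 1\<close>. In \<open>k\<close>, the
    conversion \<open>nat\<close> sends negative \<open>t\<close> to 0, but such \<open>t\<close>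
    form an \<open>F\<close>-null set.\<close>
  define g where "g n s = exp (- \<psi> s / of_nat (Suc n))" for n s
  define k where "k n t = nat \<lfloor>real (Suc n) * t\<rfloor>" for n and t :: real
  have g: "char_fun (g n)" for n
  proof -
    obtain h where h: "char_fun h" "\<And>u. \<omega> u = h u ^ Suc n"
      using \<omega> unfolding infinitely_divisible_def by (metis One_nat_def Suc_le_mono zero_le)
    have "h = g n"
      using root_eq_exp_cont_log[OF log h] by (auto simp: g_def)
    with h show ?thesis by simp
  qed
  have [measurable]: "k n \<in> measurable borel (count_space UNIV)" for n
    unfolding k_def by measurable
  have g_le: "cmod (g n s ^ m) \<le> 1" for n s m
    using char_fun_cmod_le_1[OF g] by (simp add: norm_power power_le_one)
  \<comment> \<open>Rounding down to a multiple of \<open>1 / (n + 1)\<close> changes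
    \<open>t\<close> by at most \<open>1 / (n + 1)\<close>.\<close>
  have k_lim: "(\<lambda>n. real (k n t) / real (Suc n)) \<longlonglongrightarrow> t" if "0 \<le> t" for t
  proof (rule tendsto_sandwich)
    have k: "real (k n t) = of_int \<lfloor>real (Suc n) * t\<rfloor>" for n
      using that by (simp add: k_def)
    show "\<forall>\<^sub>F n in sequentially. t - inverse (real (Suc n)) \<le> real (k n t) / real (Suc n)"
    proof (rule always_eventually, rule allI)
      fix n
      have "real (Suc n) * t - 1 \<le> real (k n t)"
        unfolding k by linarith
      then have "(real (Suc n) * t - 1) / real (Suc n) \<le> real (k n t) / real (Suc n)"
        by (rule divide_right_mono) simp
      then show "t - inverse (real (Suc n)) \<le> real (k n t) / real (Suc n)"
        by (simp add: diff_divide_distrib inverse_eq_divide del: of_nat_Suc)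
    qed
    show "\<forall>\<^sub>F n in sequentially. real (k n t) / real (Suc n) \<le> t"
    proof (rule always_eventually, rule allI)
      fix n
      have "real (k n t) \<le> real (Suc n) * t"
        unfolding k by linarith
      then show "real (k n t) / real (Suc n) \<le> t"
        by (simp add: field_simps del: of_nat_Suc)
    qed
    show "(\<lambda>n. t - inverse (real (Suc n))) \<longlonglongrightarrow> t"
      using tendsto_diff[OF tendsto_const LIMSEQ_inverse_real_of_nat, of t] by simp
  qed simp
  \<comment> \<open>The powers of the root are the exponential kernel at the rounded time, which
    links the mixtures to the Laplace integral.\<close>
  have g_pow: "g n s ^ m = exp (- \<psi> s * complex_of_real (real m / real (Suc n)))" for n s m
    by (simp add: g_def exp_of_nat_mult[symmetric] field_simps del: of_nat_Suc)
  show ?thesis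
  proof (rule char_fun_limit)
    show "char_fun (\<lambda>s. CLINT t|F. g n s ^ k n t)" for n
      by (rule char_fun_mixture[where g="\<lambda>m s. g n s ^ m"])
         (auto intro: F.prob_space_axioms char_fun_power g)
    show "(\<lambda>n. CLINT t|F. g n s ^ k n t) \<longlonglongrightarrow> \<phi> (\<psi> s)" for s
      unfolding F(3)[OF Re_\<psi>]
    proof (rule integral_dominated_convergence[where w="\<lambda>_. 1"])
      show "AE t in F. (\<lambda>n. g n s ^ k n t) \<longlonglongrightarrow> exp (- \<psi> s * complex_of_real t)"
        using F(2) unfolding g_pow by eventually_elim (intro tendsto_intros k_lim)
    qed (auto simp: g_le)
    \<comment> \<open>Since \<open>\<psi> 0 = 0\<close> lies on the boundary of the half-plane,
      continuity at 0 rests on the closed half-plane version for \<open>\<phi>\<close>.\<close>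
    have "continuous_on UNIV (\<lambda>s. \<phi> (\<psi> s))"
      by (rule continuous_on_compose2[OF continuous_on_laplace_transform[OF \<phi>] \<psi>_cont])
         (auto simp: Re_\<psi>)
    then show "isCont (\<lambda>s. \<phi> (\<psi> s)) 0"
      by (simp add: continuous_on_eq_continuous_at)
  qed
qed

section \<open>Semi-selfdecomposability of the composed law\<close>

theorem mainTheorem3:
  fixes a b \<alpha> :: real and \<omega> :: "real \<Rightarrow> complex" and \<phi> :: "complex \<Rightarrow> complex"
  assumes "0 < b" and "b < 1" and "1 < a"
    and "0 < \<alpha>" and "\<alpha> \<le> 2" and "a * b powr \<alpha> = 1"
    and "semi_stable a b \<omega>"
    and "laplace_transform \<phi>"
    and "semi_SD (b powr \<alpha>) \<phi>"
  shows "semi_selfdecomposable b (\<lambda>s. \<phi> (- cont_log \<omega> s))"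
proof -
  obtain \<psi> where \<omega>: "infinitely_divisible \<omega>" and log: "is_cont_log \<omega> (\<lambda>u. - \<psi> u)"
    and scale: "\<And>u. \<psi> u = complex_of_real a * \<psi> (b * u)"
    using \<open>semi_stable a b \<omega>\<close> unfolding semi_stable_def by blast
  obtain \<phi>\<^sub>o where \<phi>\<^sub>o: "laplace_transform \<phi>\<^sub>o"
    and fact: "\<And>s. 0 < s \<Longrightarrow>
      \<phi> (complex_of_real s) = \<phi> (complex_of_real (b powr \<alpha> * s)) * \<phi>\<^sub>o (complex_of_real s)"
    using \<open>semi_SD (b powr \<alpha>) \<phi>\<close> unfolding semi_SD_def by blast
  have Re_\<psi>: "0 \<le> Re (\<psi> s)" for s
    using \<omega> log by (intro Re_nonneg_if_char_fun) (auto simp: infinitely_divisible_def)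
  \<comment> \<open>Semi-stability expresses \<open>\<psi> s\<close> by
    \<open>\<psi> (b * s)\<close>; the relation \<open>a * b powr \<alpha> = 1\<close> inverts it,
    so scaling the argument by \<open>b\<close> multiplies the exponent by exactly the constant of
    \<open>semi_SD\<close>.\<close>
  have scale': "complex_of_real (b powr \<alpha>) * \<psi> s = \<psi> (b * s)" for s
  proof -
    have "complex_of_real (b powr \<alpha>) * \<psi> s = complex_of_real (a * b powr \<alpha>) * \<psi> (b * s)"
      using scale[of s] by simp
    then show ?thesis
      using \<open>a * b powr \<alpha> = 1\<close> by simp
  qed
  have "\<phi> (\<psi> s) = \<phi> (\<psi> (b * s)) * \<phi>\<^sub>o (\<psi> s)" for s
    using semi_SD_halfplane[OF _ \<open>laplace_transform \<phi>\<close> \<phi>\<^sub>o fact Re_\<psi>[of s]] \<open>0 < b\<close>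
    by (simp add: scale')
  \<comment> \<open>Both the law itself and its cofactor are Laplace transforms composed with the
    same exponent \<open>\<psi>\<close>, so one lemma serves for both.\<close>
  moreover have "char_fun (\<lambda>s. \<phi> (\<psi> s))" "char_fun (\<lambda>s. \<phi>\<^sub>o (\<psi> s))"
    using char_fun_laplace_transform[OF _ \<omega> log] \<open>laplace_transform \<phi>\<close> \<phi>\<^sub>o by blast+
  ultimately show ?thesis
    unfolding semi_selfdecomposable_def cont_log_eq[OF log] minus_minus
    by (intro conjI exI[of _ "\<lambda>s. \<phi>\<^sub>o (\<psi> s)"] allI)
qed

end
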